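(* Let $q,\alpha\in\mathbb{C}$ with $0<|q|<1$, let $m\in\mathbb{N}$ and $x,y\in\mathbb{C}$. Then for every $n\in\mathbb{N}_0$ both of the following identities hold: \[ \mathfrak{E}_{n,q}^{(\alpha)}(x,y)=\sum_{k=0}^{n}\begin{bmatrix} n \\ k \end{bmatrix}_q\frac{m^{k}}{m^{n-1}[k+1]_q}\left[2\sum_{j=0}^{k+1}\begin{bmatrix} k+1 \\ j \end{bmatrix}_q\left(\tfrac1m-1\right)_q^{k+1-j}\mathfrak{E}_{j,q}^{(\alpha-1)}(0,y)-\sum_{j=0}^{k+1}\begin{bmatrix} k+1 \\ j \end{bmatrix}_q\left(\tfrac1m-1\right)_q^{k+1-j}\mathfrak{E}_{j,q}^{(\alpha)}(0,y)-\mathfrak{E}_{k+1,q}^{(\alpha)}(0,y)\right]\mathfrak{B}_{n-k,q}(mx,0), \] \[ \mathfrak{E}_{n,q}^{(\alpha)}(x,y)=\sum_{k=0}^{n}\begin{bmatrix} n \\ k \end{bmatrix}_q\frac{1}{m^{n}[k+1]_q}\left[2\sum_{j=0}^{k+1}\begin{bmatrix} k+1 \\ j \end{bmatrix}_q m^{j}\mathfrak{E}_{j,q}^{(\alpha-1)}(x,-1)-\sum_{j=0}^{k+1}\begin{bmatrix} k+1 \\ j \end{bmatrix}_q m^{j}\mathfrak{E}_{j,q}^{(\alpha)}(x,-1)-m^{k+1}\mathfrak{E}_{k+1,q}^{(\alpha)}(x,0)\right]\mathfrak{B}_{n-k,q}(0,my). \]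
   Context: $\mathbb{N}=\{1,2,\dots\}$, $\mathbb{N}_0=\mathbb{N}\cup\{0\}$. For $q\in\mathbb{C}$, $0<|q|<1$: $[n]_q=\frac{1-q^n}{1-q}$, $[0]_q!=1$, $[n]_q!=[1]_q[2]_q\cdots[n]_q$, and $\begin{bmatrix} n \\ k \end{bmatrix}_q=\frac{[n]_q!}{[k]_q![n-k]_q!}$ for $0\le k\le n$. For $n\in\mathbb{N}_0$, $(a+b)_q^{n}:=\sum_{k=0}^n\begin{bmatrix} n \\ k \end{bmatrix}_q q^{k(k-1)/2}a^{n-k}b^k$; thus $(\frac1m-1)_q^n$ is this expression with $a=\frac1m$, $b=-1$. Set $e_q(z)=\sum_{n\ge0}\frac{z^n}{[n]_q!}$ and $E_q(z)=\sum_{n\ge0}\frac{q^{n(n-1)/2}z^n}{[n]_q!}$. For $\alpha\in\mathbb{C}$ the $q$-Bernoulli and $q$-Euler polynomials of order $\alpha$ are defined by the power series expansions in $t$ around $0$ \[ \left(\frac{t}{e_q(t)-1}\right)^{\alpha}e_q(tx)E_q(ty)=\sum_{n=0}^\infty\mathfrak{B}_{n,q}^{(\alpha)}(x,y)\frac{t^n}{[n]_q!},\qquad \left(\frac{2}{e_q(t)+1}\right)^{\alpha}e_q(tx)E_q(ty)=\sum_{n=0}^\infty\mathfrak{E}_{n,q}^{(\alpha)}(x,y)\frac{t^n}{[n]_q!}, \] where the $\alpha$-th power of a power series with constant term $1$ is the one with constant term $1$. Write $\mathfrak{B}_{n,q}(x,y)=\mathfrak{B}_{n,q}^{(1)}(x,y)$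 and $\mathfrak{E}_{n,q}(x,y)=\mathfrak{E}_{n,q}^{(1)}(x,y)$. *)

theory Defs
  imports Complex_Main "HOL-Computational_Algebra.Formal_Power_Series"
begin

definition qint :: "complex \<Rightarrow> nat \<Rightarrow> complex" where
  "qint q n = (1 - q ^ n) / (1 - q)"

definition qfact :: "complex \<Rightarrow> nat \<Rightarrow> complex" where
  "qfact q n = (\<Prod>i=1..n. qint q i)"

(* Only meaningful for k <= n; used only in that range. *)
definition qbinomial :: "complex \<Rightarrow> nat \<Rightarrow> nat \<Rightarrow> complex" where
  "qbinomial q n k = qfact q n / (qfact q k * qfact q (n - k))"

definition qadd_power :: "complex \<Rightarrow> complex \<Rightarrow> complex \<Rightarrow> nat \<Rightarrow> complex" where
  "qadd_power q a b n =
     (\<Sum>k=0..n. qbinomial q n k * q ^ (k * (k - 1) div 2) * a ^ (n - k) * b ^ k)"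

(* The q-exponentials e_q(c t) and E_q(c t), as formal power series in t. *)

definition fps_qexp :: "complex \<Rightarrow> complex \<Rightarrow> complex fps" where
  "fps_qexp q c = Abs_fps (\<lambda>n. c ^ n / qfact q n)"

definition fps_qExp :: "complex \<Rightarrow> complex \<Rightarrow> complex fps" where
  "fps_qExp q c = Abs_fps (\<lambda>n. q ^ (n * (n - 1) div 2) * c ^ n / qfact q n)"

(* Power of a series with constant term 1, through Newton's binomial series:
   f^a = sum_n (a gchoose n) (f - 1)^n.  Junk value if the constant term is not 1. *)
definition fps_cpow :: "complex fps \<Rightarrow> complex \<Rightarrow> complex fps" where
  "fps_cpow f a = fps_binomial a oo (f - 1)"

(* Numerator and denominator of the Bernoulli quotient both have order 1 at t = 0;
   fps division cancels the common factor t. *)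
definition qBernoulli_gf :: "complex \<Rightarrow> complex \<Rightarrow> complex \<Rightarrow> complex \<Rightarrow> complex fps" where
  "qBernoulli_gf q \<alpha> x y =
     fps_cpow (fps_X / (fps_qexp q 1 - 1)) \<alpha> * fps_qexp q x * fps_qExp q y"

definition qEuler_gf :: "complex \<Rightarrow> complex \<Rightarrow> complex \<Rightarrow> complex \<Rightarrow> complex fps" where
  "qEuler_gf q \<alpha> x y =
     fps_cpow (2 / (fps_qexp q 1 + 1)) \<alpha> * fps_qexp q x * fps_qExp q y"

(* Index order: base q, order \<alpha>, degree n, arguments x and y. *)

definition qBernoulli :: "complex \<Rightarrow> complex \<Rightarrow> nat \<Rightarrow> complex \<Rightarrow> complex \<Rightarrow> complex" where
  "qBernoulli q \<alpha> n x y = qfact q n * fps_nth (qBernoulli_gf q \<alpha> x y) n"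

definition qEuler :: "complex \<Rightarrow> complex \<Rightarrow> nat \<Rightarrow> complex \<Rightarrow> complex \<Rightarrow> complex" where
  "qEuler q \<alpha> n x y = qfact q n * fps_nth (qEuler_gf q \<alpha> x y) n"

lemma qfact_0 [simp]: "qfact q 0 = 1"
  by (simp add: qfact_def)

lemma qfact_nonzero:
  assumes "norm q < 1"
  shows "qfact q n \<noteq> 0"
proof -
  have "q ^ i \<noteq> 1" if "i \<ge> 1" for i
  proof
    assume "q ^ i = 1"
    hence "norm q ^ i = 1" by (metis norm_power norm_one)
    moreover have "norm q ^ i < 1"
      using power_decreasing[of 1 i "norm q"] assms that by simp
    ultimately show False by simp
  qed
  moreover have "q \<noteq> 1" using assms by auto
  ultimately show ?thesis by (auto simp: qfact_def qint_def)
qed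

lemma qBernoulli_gf_expansion:
  assumes "norm q < 1"
  shows "qBernoulli_gf q \<alpha> x y = Abs_fps (\<lambda>n. qBernoulli q \<alpha> n x y / qfact q n)"
  using qfact_nonzero[OF assms] by (simp add: fps_eq_iff qBernoulli_def)

lemma qEuler_gf_expansion:
  assumes "norm q < 1"
  shows "qEuler_gf q \<alpha> x y = Abs_fps (\<lambda>n. qEuler q \<alpha> n x y / qfact q n)"
  using qfact_nonzero[OF assms] by (simp add: fps_eq_iff qEuler_def)

lemma fps_qexp_compose: "fps_qexp q c = fps_qexp q 1 oo (fps_const c * fps_X)"
  by (simp add: fps_eq_iff fps_qexp_def fps_compose_linear)

lemma fps_qExp_compose: "fps_qExp q c = fps_qExp q 1 oo (fps_const c * fps_X)"
  by (simp add: fps_eq_iff fps_qExp_def fps_compose_linear)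

lemma fps_qexp_minus_1_mult:
  assumes "norm q < 1"
  shows "fps_X / (fps_qexp q 1 - 1) * (fps_qexp q 1 - 1) = fps_X"
    and "fps_nth (fps_X / (fps_qexp q 1 - 1)) 0 = 1"
proof -
  have q1: "qint q 1 = 1" using assms by (auto simp: qint_def)
  have n0: "fps_nth (fps_qexp q 1 - 1) 0 = 0" by (simp add: fps_qexp_def)
  have n1: "fps_nth (fps_qexp q 1 - 1) 1 = 1"
    using q1 by (simp add: fps_qexp_def qfact_def)
  have sd: "subdegree (fps_qexp q 1 - 1) = 1"
    using n0 n1 by (intro subdegreeI) auto
  have "fps_qexp q 1 - 1 dvd fps_X"
    using sd n1 by (subst fps_dvd_iff) auto
  thus *: "fps_X / (fps_qexp q 1 - 1) * (fps_qexp q 1 - 1) = fps_X"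
    by (rule dvd_div_mult_self)
  have "fps_nth (fps_X / (fps_qexp q 1 - 1) * (fps_qexp q 1 - 1)) 1
        = fps_nth (fps_X / (fps_qexp q 1 - 1)) 0"
    using n0 n1 by (simp add: fps_mult_nth)
  thus "fps_nth (fps_X / (fps_qexp q 1 - 1)) 0 = 1"
    by (simp add: *)
qed

lemma fps_qexp_plus_1_mult: "2 / (fps_qexp q 1 + 1) * (fps_qexp q 1 + 1) = 2"
  and fps_nth_2_div_qexp: "fps_nth (2 / (fps_qexp q 1 + 1)) 0 = 1"
proof -
  have n0: "fps_nth (fps_qexp q 1 + 1) 0 = 2" by (simp add: fps_qexp_def)
  show "2 / (fps_qexp q 1 + 1) * (fps_qexp q 1 + 1) = 2"
    using n0 by (simp add: fps_divide_unit mult.assoc inverse_mult_eq_1)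
  show "fps_nth (2 / (fps_qexp q 1 + 1)) 0 = 1"
    using n0 by (simp add: fps_divide_unit fps_mult_nth)
qed

lemma fps_cpow_nth_0: "fps_nth (fps_cpow f a) 0 = 1"
  by (simp add: fps_cpow_def)

lemma fps_cpow_add:
  assumes "fps_nth f 0 = 1"
  shows "fps_cpow f (a + b) = fps_cpow f a * fps_cpow f b"
  using assms by (simp add: fps_cpow_def fps_binomial_add_mult fps_compose_mult_distrib)

lemma fps_cpow_of_nat:
  assumes "fps_nth f 0 = 1"
  shows "fps_cpow f (of_nat n) = f ^ n"
  using assms
  by (simp add: fps_cpow_def fps_binomial_of_nat fps_compose_add_distrib
      flip: fps_compose_power)

end

theory Submission
  imports Defs
begin

text \<open>
  Put $F_\alpha(t) = (2/(e_q(t)+1))^\alpha$, so that $2F_{\alpha-1} = F_\alpha \cdot (e_q(t)+1)$, and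
  recall $e_q(t)\,E_q(-t) = 1$. For every series $P = F_\alpha R$ and every $c$ these two facts give
  \[ 2 F_{\alpha-1} R\, e_q(ct) E_q(-t) - P\, e_q(ct) E_q(-t) - P = P \cdot (e_q(ct) - 1). \]
  With $c = 1/m$ the left-hand side generates the square brackets of both identities: in the first one
  $R = E_q(ty)$, and $e_q(t/m) E_q(-t)$ generates $(1/m - 1)_q^n$; in the second one $R = e_q(tx)$,
  the factor $E_q(-t)$ is the second argument $-1$ of the Euler polynomials, $e_q(t/m)$ supplies
  the powers $m^{-(k+1-j)}$, and an overall factor $m^{k+1}$ is taken out of the bracket.
  These are \<open>qEuler_bracket_qadd\<close> and \<open>qEuler_bracket_power\<close>.

  In both identities the bracket is then weighted by $m^{k+1}/m^n$. These powers of $m$ account for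
  the rescaling $t \mapsto mt$, under which $e_q(t/m) - 1$ becomes $e_q(t) - 1$, the denominator of
  the Bernoulli generating function. The two cancel (\<open>qBernoulli_cancel_sum\<close>), and the
  $q$-exponential $e_q(tx)$ or $E_q(ty)$ that remains from the Bernoulli polynomials completes $P$
  to the generating function of $\mathfrak{E}_{n,q}^{(\alpha)}(x,y)$.
\<close>

section \<open>The $q$-exponentials\<close>

lemma qfact_Suc: "qfact q (Suc n) = qfact q n * qint q (Suc n)"
  by (simp add: qfact_def)

lemma fps_qexp_0 [simp]: "fps_qexp q 0 = 1"
  by (simp add: fps_eq_iff fps_qexp_def power_0_left)

lemma fps_qExp_0 [simp]: "fps_qExp q 0 = 1"
  by (simp add: fps_eq_iff fps_qExp_def power_0_left)

lemma fps_qexp_scale: "fps_qexp q a oo (fps_const c * fps_X) = fps_qexp q (c * a)"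
  by (simp add: fps_eq_iff fps_qexp_def fps_compose_linear power_mult_distrib)

lemma fps_qExp_scale: "fps_qExp q a oo (fps_const c * fps_X) = fps_qExp q (c * a)"
  by (simp add: fps_eq_iff fps_qExp_def fps_compose_linear power_mult_distrib)

lemma power_neq_1:
  fixes q :: complex
  assumes "norm q < 1" and "n > 0"
  shows "q ^ n \<noteq> 1"
proof
  assume "q ^ n = 1"
  hence "norm q ^ n = 1" by (metis norm_power norm_one)
  moreover have "norm q ^ n < 1"
    using assms by (simp add: power_less_one_iff)
  ultimately show False by simp
qed

lemma qint_Suc_nonzero:
  assumes "norm q < 1"
  shows "qint q (Suc n) \<noteq> 0"
  using qfact_nonzero[OF assms, of "Suc n"] by (auto simp: qfact_Suc)

text \<open>On coefficients, this says $1 - q^n = (1-q)[n]_q$.\<close>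

lemma fps_qexp_q_difference:
  assumes "norm q < 1"
  shows "fps_qexp q q = (1 - fps_const (1 - q) * fps_X) * fps_qexp q 1"
proof (rule fps_ext)
  fix n
  show "fps_nth (fps_qexp q q) n =
        fps_nth ((1 - fps_const (1 - q) * fps_X) * fps_qexp q 1) n"
  proof (cases n)
    case 0
    then show ?thesis by (simp add: fps_qexp_def left_diff_distrib mult.assoc)
  next
    case (Suc k)
    have "q \<noteq> 1" using assms by auto
    hence "(1 - q) * qint q (Suc k) = 1 - q ^ Suc k" by (simp add: qint_def)
    then show ?thesis
      using Suc qfact_nonzero[OF assms, of k] qint_Suc_nonzero[OF assms, of k]
      by (simp add: fps_qexp_def left_diff_distrib mult.assoc qfact_Suc field_simps)
  qed
qed

lemma fps_qExp_q_difference: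
  assumes "norm q < 1"
  shows "fps_qExp q (- 1) = (1 - fps_const (1 - q) * fps_X) * fps_qExp q (- q)"
proof (rule fps_ext)
  fix n
  show "fps_nth (fps_qExp q (- 1)) n =
        fps_nth ((1 - fps_const (1 - q) * fps_X) * fps_qExp q (- q)) n"
  proof (cases n)
    case 0
    then show ?thesis by (simp add: fps_qExp_def left_diff_distrib mult.assoc)
  next
    case (Suc k)
    have "q \<noteq> 1" using assms by auto
    hence i: "(1 - q) * qint q (Suc k) = 1 - q ^ Suc k" by (simp add: qint_def)
    define T where "T = q ^ (k * (k - 1) div 2)"
    have "Suc k * (Suc k - 1) div 2 = k * (k - 1) div 2 + k"
      by (cases k) (simp_all add: algebra_simps)
    hence t: "q ^ (Suc k * (Suc k - 1) div 2) = T * q ^ k"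
      by (simp only: power_add T_def)
    have m: "(- q) ^ j = (- 1) ^ j * q ^ j" for j
      using power_mult_distrib[of "- 1" q j] by simp
    have "fps_nth ((1 - fps_const (1 - q) * fps_X) * fps_qExp q (- q)) n
        = T * q ^ k * (- q) ^ Suc k / qfact q (Suc k) - (1 - q) * (T * (- q) ^ k / qfact q k)"
      using Suc t by (simp add: fps_qExp_def left_diff_distrib mult.assoc T_def)
    also have "\<dots> = (T * q ^ k * (- q) ^ Suc k - (1 - q) * qint q (Suc k) * T * (- q) ^ k)
                    / qfact q (Suc k)"
      using qfact_nonzero[OF assms, of k] qint_Suc_nonzero[OF assms, of k]
      by (simp add: qfact_Suc divide_simps)
    also have "\<dots> = T * q ^ k * (- 1) ^ Suc k / qfact q (Suc k)"
      unfolding i m by (simp add: algebra_simps)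
    also have "\<dots> = fps_nth (fps_qExp q (- 1)) n"
      unfolding Suc fps_qExp_def fps_nth_Abs_fps t ..
    finally show ?thesis ..
  qed
qed

text \<open>
  By the two $q$-difference equations the product $f(t) = e_q(t) E_q(-t)$ satisfies
  $f(qt) = f(t)$. As $q^n \<noteq> 1$ for $n > 0$, only the constant term survives.
\<close>

lemma fps_qexp_mult_qExp_uminus:
  assumes "norm q < 1"
  shows "fps_qexp q 1 * fps_qExp q (- 1) = 1"
proof (rule fps_ext)
  let ?f = "fps_qexp q 1 * fps_qExp q (- 1)"
  fix n
  have "?f oo (fps_const q * fps_X) = fps_qexp q q * fps_qExp q (- q)"
    by (simp add: fps_compose_mult_distrib fps_qexp_scale fps_qExp_scale)
  also have "\<dots> = fps_qexp q 1 * ((1 - fps_const (1 - q) * fps_X) * fps_qExp q (- q))"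
    by (simp only: fps_qexp_q_difference[OF assms] mult.assoc mult.left_commute)
  also have "\<dots> = ?f"
    by (simp only: fps_qExp_q_difference[OF assms])
  finally have "fps_nth (?f oo (fps_const q * fps_X)) n = fps_nth ?f n"
    by simp
  hence "q ^ n * fps_nth ?f n = fps_nth ?f n"
    by (simp only: fps_compose_linear fps_nth_Abs_fps)
  then show "fps_nth ?f n = fps_nth 1 n"
    using power_neq_1[OF assms, of n]
    by (cases "n = 0") (simp_all add: fps_qexp_def fps_qExp_def)
qed

section \<open>$q$-binomial convolutions\<close>

text \<open>The $q$-exponential generating function turns $q$-binomial convolutions into products.\<close>

lemma qbinomial_convolution:
  assumes "norm q < 1"
  shows "(\<Sum>j=0..n. qbinomial q n j * (qfact q (n - j) * fps_nth g (n - j))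
                     * (qfact q j * fps_nth f j))
         = qfact q n * fps_nth (f * g) n"
proof -
  have "qbinomial q n j * (qfact q (n - j) * fps_nth g (n - j)) * (qfact q j * fps_nth f j)
        = qfact q n * (fps_nth f j * fps_nth g (n - j))" for j
    using qfact_nonzero[OF assms] by (simp add: qbinomial_def)
  then show ?thesis
    by (simp only: fps_mult_nth sum_distrib_left)
qed

lemma power_eq_qfact_fps_qexp:
  assumes "norm q < 1"
  shows "a ^ n = qfact q n * fps_nth (fps_qexp q a) n"
  using qfact_nonzero[OF assms] by (simp add: fps_qexp_def)

lemma qadd_power_eq_qfact_fps:
  assumes "norm q < 1"
  shows "qadd_power q a b n = qfact q n * fps_nth (fps_qexp q a * fps_qExp q b) n"
proof -
  have "qadd_power q a b n = (\<Sum>k=0..n. qbinomial q n k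
          * (qfact q (n - k) * fps_nth (fps_qexp q a) (n - k))
          * (qfact q k * fps_nth (fps_qExp q b) k))"
    unfolding qadd_power_def
    using qfact_nonzero[OF assms]
    by (intro sum.cong) (simp_all add: fps_qexp_def fps_qExp_def)
  then show ?thesis
    by (simp only: qbinomial_convolution[OF assms] mult.commute[of "fps_qexp q a"])
qed

section \<open>Generating functions of the square brackets\<close>

lemma qEuler_gf_order_shift:
  "2 * qEuler_gf q (\<alpha> - 1) x y = qEuler_gf q \<alpha> x y * (fps_qexp q 1 + 1)"
proof -
  let ?h = "2 / (fps_qexp q 1 + 1)"
  have "fps_cpow ?h \<alpha> = fps_cpow ?h (\<alpha> - 1) * ?h"
    using fps_cpow_add[OF fps_nth_2_div_qexp, of q "\<alpha> - 1" 1]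
      fps_cpow_of_nat[OF fps_nth_2_div_qexp, of q 1] by simp
  hence "fps_cpow ?h \<alpha> * (fps_qexp q 1 + 1) = fps_cpow ?h (\<alpha> - 1) * 2"
    by (simp only: mult.assoc fps_qexp_plus_1_mult)
  then show ?thesis
    unfolding qEuler_gf_def by (simp only: mult_ac)
qed

text \<open>
  In $2F_{\alpha-1} = F_\alpha \cdot (e_q(t)+1)$ the summand $e_q(t)$ cancels $E_q(-t)$, and the
  summand $1$ gives the first subtracted term.
\<close>

lemma qEuler_gf_bracket:
  assumes "norm q < 1"
  shows "2 * (qEuler_gf q (\<alpha> - 1) x y * (fps_qexp q c * fps_qExp q (- 1)))
           - qEuler_gf q \<alpha> x y * (fps_qexp q c * fps_qExp q (- 1)) - qEuler_gf q \<alpha> x y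
         = qEuler_gf q \<alpha> x y * (fps_qexp q c - 1)"
proof -
  let ?P = "qEuler_gf q \<alpha> x y" and ?e = "fps_qexp q 1" and ?E = "fps_qExp q (- 1)"
  have "2 * (qEuler_gf q (\<alpha> - 1) x y * (fps_qexp q c * ?E)) = ?P * (?e + 1) * (fps_qexp q c * ?E)"
    by (simp only: mult.assoc flip: qEuler_gf_order_shift)
  also have "\<dots> = ?P * fps_qexp q c * (?e * ?E) + ?P * (fps_qexp q c * ?E)"
    by (simp add: algebra_simps)
  finally show ?thesis
    by (simp add: fps_qexp_mult_qExp_uminus[OF assms] algebra_simps)
qed

lemma qEuler_bracket_qadd:
  assumes "norm q < 1"
  shows "2 * (\<Sum>j=0..n. qbinomial q n j * qadd_power q c (- 1) (n - j) * qEuler q (\<alpha> - 1) j x y)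
           - (\<Sum>j=0..n. qbinomial q n j * qadd_power q c (- 1) (n - j) * qEuler q \<alpha> j x y)
           - qEuler q \<alpha> n x y
         = qfact q n * fps_nth (qEuler_gf q \<alpha> x y * (fps_qexp q c - 1)) n"
  unfolding qadd_power_eq_qfact_fps[OF assms] qEuler_def qbinomial_convolution[OF assms]
    qEuler_gf_bracket[OF assms, symmetric]
  by (simp only: mult_2 distrib_left right_diff_distrib fps_add_nth fps_sub_nth)

text \<open>
  Here $E_q(-t)$ enters through the second argument of the Euler polynomials, and writing
  $m^j = m^n (1/m)^{n-j}$ exposes the coefficients of $e_q(t/m)$.
\<close>

lemma qEuler_bracket_power:
  assumes "norm q < 1" and "c \<noteq> 0"
  shows "2 * (\<Sum>j=0..n. qbinomial q n j * c ^ j * qEuler q (\<alpha> - 1) j x (- 1))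
           - (\<Sum>j=0..n. qbinomial q n j * c ^ j * qEuler q \<alpha> j x (- 1))
           - c ^ n * qEuler q \<alpha> n x 0
         = c ^ n * (qfact q n * fps_nth (qEuler_gf q \<alpha> x 0 * (fps_qexp q (1 / c) - 1)) n)"
proof -
  have sum_eq: "(\<Sum>j=0..n. qbinomial q n j * c ^ j * qEuler q \<beta> j x (- 1))
      = c ^ n * (qfact q n
          * fps_nth (qEuler_gf q \<beta> x 0 * (fps_qexp q (1 / c) * fps_qExp q (- 1))) n)" for \<beta>
  proof -
    have "(\<Sum>j=0..n. qbinomial q n j * c ^ j * qEuler q \<beta> j x (- 1))
        = c ^ n * (\<Sum>j=0..n. qbinomial q n j * (1 / c) ^ (n - j) * qEuler q \<beta> j x (- 1))"
      unfolding sum_distrib_left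
      using assms(2) by (intro sum.cong) (simp_all add: power_diff power_one_over)
    also have "\<dots> = c ^ n * (qfact q n
        * fps_nth (qEuler_gf q \<beta> x (- 1) * fps_qexp q (1 / c)) n)"
      unfolding power_eq_qfact_fps_qexp[OF assms(1), of "1 / c"] qEuler_def
        qbinomial_convolution[OF assms(1)] ..
    also have "qEuler_gf q \<beta> x (- 1) * fps_qexp q (1 / c)
        = qEuler_gf q \<beta> x 0 * (fps_qexp q (1 / c) * fps_qExp q (- 1))"
      by (simp add: qEuler_gf_def mult_ac)
    finally show ?thesis .
  qed
  show ?thesis
    unfolding sum_eq unfolding qEuler_def qEuler_gf_bracket[OF assms(1), symmetric]
    by (simp only: mult_2 distrib_left right_diff_distrib fps_add_nth fps_sub_nth)
qed

section \<open>Cancellation against the $q$-Bernoulli generating function\<close>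

text \<open>
  Dividing the bracket by $[k+1]_q$ shifts its generating function down by one power of $t$, which
  is the factor $t$ in the numerator of $t/(e_q(t)-1)$.
\<close>

lemma qBernoulli_cancel_sum_unscaled:
  assumes "norm q < 1"
  shows "(\<Sum>k=0..n. qbinomial q n k * (1 / qint q (k + 1))
            * (qfact q (k + 1) * fps_nth (L * (fps_qexp q 1 - 1)) (k + 1))
            * qBernoulli q 1 (n - k) u v)
         = qfact q n * fps_nth (L * fps_qexp q u * fps_qExp q v) n"
proof -
  let ?d = "fps_qexp q 1 - 1"
  let ?G = "L * ?d" and ?B = "qBernoulli_gf q 1 u v"
  have "fps_nth ?G 0 = 0"
    by (simp add: fps_qexp_def)
  hence G: "?G = fps_X * fps_shift 1 ?G"
    by (intro fps_ext) (simp add: fps_X_mult_nth)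
  have "fps_cpow (fps_X / ?d) 1 = fps_X / ?d"
    using fps_cpow_of_nat[OF fps_qexp_minus_1_mult(2)[OF assms], of 1] by simp
  hence B: "?B * ?d = fps_X * fps_qexp q u * fps_qExp q v"
    using fps_qexp_minus_1_mult(1)[OF assms]
    by (simp add: qBernoulli_gf_def mult_ac)
  have "fps_X * (fps_shift 1 ?G * ?B) = L * (?B * ?d)"
    by (subst mult.assoc[symmetric], subst G[symmetric]) (simp only: mult_ac)
  also have "\<dots> = fps_X * (L * fps_qexp q u * fps_qExp q v)"
    by (simp only: B mult_ac)
  finally have shift: "fps_shift 1 ?G * ?B = L * fps_qexp q u * fps_qExp q v"
    by simp
  have "(\<Sum>k=0..n. qbinomial q n k * (1 / qint q (k + 1))
            * (qfact q (k + 1) * fps_nth ?G (k + 1)) * qBernoulli q 1 (n - k) u v)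
      = (\<Sum>k=0..n. qbinomial q n k * (qfact q (n - k) * fps_nth ?B (n - k))
            * (qfact q k * fps_nth (fps_shift 1 ?G) k))"
    using qint_Suc_nonzero[OF assms]
    by (intro sum.cong) (simp_all add: qfact_Suc qBernoulli_def)
  also have "\<dots> = qfact q n * fps_nth (L * fps_qexp q u * fps_qExp q v) n"
    by (simp only: qbinomial_convolution[OF assms] shift)
  finally show ?thesis .
qed

lemma qBernoulli_cancel_sum:
  assumes "norm q < 1" and "c \<noteq> 0"
  shows "(\<Sum>k=0..n. qbinomial q n k * (c ^ (k + 1) / (c ^ n * qint q (k + 1)))
            * (qfact q (k + 1) * fps_nth (P * (fps_qexp q (1 / c) - 1)) (k + 1))
            * qBernoulli q 1 (n - k) (c * u) (c * v))
         = qfact q n * fps_nth (P * fps_qexp q u * fps_qExp q v) n"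
proof -
  let ?S = "fps_const c * fps_X"
  have scale: "fps_nth (f oo ?S) k = c ^ k * fps_nth f k" for f k
    by (simp add: fps_compose_linear)
  have bracket: "(P * (fps_qexp q (1 / c) - 1)) oo ?S = (P oo ?S) * (fps_qexp q 1 - 1)"
    using assms(2) by (simp add: fps_compose_mult_distrib fps_compose_sub_distrib fps_qexp_scale)
  have bracket_nth: "fps_nth ((P oo ?S) * (fps_qexp q 1 - 1)) k
      = c ^ k * fps_nth (P * (fps_qexp q (1 / c) - 1)) k" for k
    by (simp only: scale flip: bracket)
  have result: "(P * fps_qexp q u * fps_qExp q v) oo ?S
      = (P oo ?S) * fps_qexp q (c * u) * fps_qExp q (c * v)"
    by (simp add: fps_compose_mult_distrib fps_qexp_scale fps_qExp_scale)
  have "(\<Sum>k=0..n. qbinomial q n k * (c ^ (k + 1) / (c ^ n * qint q (k + 1)))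
            * (qfact q (k + 1) * fps_nth (P * (fps_qexp q (1 / c) - 1)) (k + 1))
            * qBernoulli q 1 (n - k) (c * u) (c * v))
      = 1 / c ^ n * (\<Sum>k=0..n. qbinomial q n k * (1 / qint q (k + 1))
            * (qfact q (k + 1) * fps_nth ((P oo ?S) * (fps_qexp q 1 - 1)) (k + 1))
            * qBernoulli q 1 (n - k) (c * u) (c * v))"
    unfolding sum_distrib_left bracket_nth
    by (intro sum.cong refl)
      (simp only: divide_inverse inverse_mult_distrib mult_1_left mult_ac)
  also have "\<dots> = 1 / c ^ n
      * (qfact q n * fps_nth ((P * fps_qexp q u * fps_qExp q v) oo ?S) n)"
    by (simp only: qBernoulli_cancel_sum_unscaled[OF assms(1)] result)
  also have "\<dots> = qfact q n * fps_nth (P * fps_qexp q u * fps_qExp q v) n"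
    using assms(2) by (simp add: scale)
  finally show ?thesis .
qed

section \<open>$q$-Euler polynomials in terms of $q$-Bernoulli polynomials\<close>

theorem theorem13:
  fixes q \<alpha> x y :: complex and m n :: nat
  assumes "0 < norm q" and "norm q < 1" and "m \<ge> 1"
  shows
    "qEuler q \<alpha> n x y =
       (\<Sum>k=0..n. qbinomial q n k
          * (of_nat m ^ k / (of_nat m powi (int n - 1) * qint q (k + 1)))
          * (2 * (\<Sum>j=0..k+1. qbinomial q (k + 1) j
                    * qadd_power q (1 / of_nat m) (-1) (k + 1 - j) * qEuler q (\<alpha> - 1) j 0 y)
             - (\<Sum>j=0..k+1. qbinomial q (k + 1) j
                    * qadd_power q (1 / of_nat m) (-1) (k + 1 - j) * qEuler q \<alpha> j 0 y)
             - qEuler q \<alpha> (k + 1) 0 y)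
          * qBernoulli q 1 (n - k) (of_nat m * x) 0)
     \<and>
     qEuler q \<alpha> n x y =
       (\<Sum>k=0..n. qbinomial q n k
          * (1 / (of_nat m ^ n * qint q (k + 1)))
          * (2 * (\<Sum>j=0..k+1. qbinomial q (k + 1) j
                    * of_nat m ^ j * qEuler q (\<alpha> - 1) j x (-1))
             - (\<Sum>j=0..k+1. qbinomial q (k + 1) j
                    * of_nat m ^ j * qEuler q \<alpha> j x (-1))
             - of_nat m ^ (k + 1) * qEuler q \<alpha> (k + 1) x 0)
          * qBernoulli q 1 (n - k) 0 (of_nat m * y))"
proof
  let ?m = "of_nat m :: complex"
  have m0: "?m \<noteq> 0" using assms(3) by simp
  note q = assms(2)
  \<comment> \<open>The integer exponent covers $n = 0$, where the weight is $m^{k+1}$.\<close>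
  have coeff: "?m ^ k / (?m powi (int n - 1) * qint q (k + 1))
      = ?m ^ (k + 1) / (?m ^ n * qint q (k + 1))" for k
    using m0 by (simp add: power_int_diff)
  show "qEuler q \<alpha> n x y =
       (\<Sum>k=0..n. qbinomial q n k
          * (?m ^ k / (?m powi (int n - 1) * qint q (k + 1)))
          * (2 * (\<Sum>j=0..k+1. qbinomial q (k + 1) j
                    * qadd_power q (1 / ?m) (-1) (k + 1 - j) * qEuler q (\<alpha> - 1) j 0 y)
             - (\<Sum>j=0..k+1. qbinomial q (k + 1) j
                    * qadd_power q (1 / ?m) (-1) (k + 1 - j) * qEuler q \<alpha> j 0 y)
             - qEuler q \<alpha> (k + 1) 0 y)
          * qBernoulli q 1 (n - k) (?m * x) 0)"
    unfolding qEuler_bracket_qadd[OF q] coeff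
    using qBernoulli_cancel_sum[OF q m0, of n "qEuler_gf q \<alpha> 0 y" x 0]
    by (simp add: qEuler_def qEuler_gf_def mult_ac)
  have bracket_factor: "qbinomial q n k * (1 / (?m ^ n * qint q (k + 1))) * (?m ^ (k + 1) * z)
      = qbinomial q n k * (?m ^ (k + 1) / (?m ^ n * qint q (k + 1))) * z" for k z
    by simp
  show "qEuler q \<alpha> n x y =
       (\<Sum>k=0..n. qbinomial q n k
          * (1 / (?m ^ n * qint q (k + 1)))
          * (2 * (\<Sum>j=0..k+1. qbinomial q (k + 1) j
                    * ?m ^ j * qEuler q (\<alpha> - 1) j x (-1))
             - (\<Sum>j=0..k+1. qbinomial q (k + 1) j
                    * ?m ^ j * qEuler q \<alpha> j x (-1))
             - ?m ^ (k + 1) * qEuler q \<alpha> (k + 1) x 0)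
          * qBernoulli q 1 (n - k) 0 (?m * y))"
    unfolding qEuler_bracket_power[OF q m0] bracket_factor
    using qBernoulli_cancel_sum[OF q m0, of n "qEuler_gf q \<alpha> x 0" 0 y]
    by (simp add: qEuler_def qEuler_gf_def mult_ac)
qed

end
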